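(* Let $k,n,N$ be positive integers with $N\geq 2$, and let $\phi:(\mathbb{R}^n)^k\to\mathbb{R}^{N+1}$ be a $k$-linear map defined over $\mathbb{Q}$ such that $\phi((\mathbb{Q}^n)^k)$ spans $\mathbb{R}^{N+1}$ over $\mathbb{R}$. Let $Z$ denote the topological closure in $\mathbb{P}^N(\mathbb{R})$ of the projectivization of $\phi((\mathbb{R}^n)^k)$, i.e. of the set $\{[\phi(\mathbf{x}_1,\dots,\mathbf{x}_k)]\,;\,\mathbf{x}_i\in\mathbb{R}^n,\ \phi(\mathbf{x}_1,\dots,\mathbf{x}_k)\neq 0\}$. Then there are uncountably many $\xi\in Z^{\mathrm{li}}$ such that $\widehat{\lambda}(\xi)=1$, and so $\widehat{\lambda}(Z)=1$.
   Context: For a nonzero $\mathbf{x}\in\mathbb{R}^{m+1}$, $[\mathbf{x}]$ denotes its class in $\mathbb{P}^m(\mathbb{R})$. For $Z\subseteq\mathbb{P}^m(\mathbb{R})$, $Z^{\mathrm{li}}$ is the set of points of $Z$ having a representative in $\mathbb{R}^{m+1}$ whose coordinates are linearly independent over $\mathbb{Q}$. The topology on $\mathbb{P}^m(\mathbb{R})$ is the one induced by the projective distance $\mathrm{dist}([\mathbf{x}],[\mathbf{y}])=\|\mathbf{x}\wedge\mathbf{y}\|/(\|\mathbf{x}\|\,\|\mathbf{y}\|)$, with $\|\cdot\|$ the Euclidean norm. For $\xi=[\boldsymbol{\xi}]\in\mathbb{P}^m(\mathbb{R})$ and nonzero $\mathbf{x}\in\mathbb{Z}^{m+1}$ set $D_\xi(\mathbf{x})=\|\mathbf{x}\wedge\boldsymbol{\xi}\|/\|\boldsymbol{\xi}\|$,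 and for $X\geq1$ set $\mathcal{D}_\xi(X)=\min\{D_\xi(\mathbf{x})\,;\,\mathbf{x}\in\mathbb{Z}^{m+1}\setminus\{0\},\ \|\mathbf{x}\|\leq X\}$. The uniform exponent $\widehat{\lambda}(\xi)$ is the supremum of all $\lambda\in\mathbb{R}$ such that $\mathcal{D}_\xi(X)\leq X^{-\lambda}$ for all sufficiently large $X$. For $Z\subseteq\mathbb{P}^m(\mathbb{R})$, $\widehat{\lambda}(Z)=\sup\{\widehat{\lambda}(\xi)\,;\,\xi\in Z^{\mathrm{li}}\}$. *)

theory Defs
  imports "HOL-Analysis.Analysis"
begin

section \<open>The norm of a wedge product\<close>

text \<open>The coordinates of \<open>x \<and> y\<close> with respect to the usual orthonormal basis are the minors
  \<open>x\<^sub>i y\<^sub>j - x\<^sub>j y\<^sub>i\<close>, one for each unordered pair \<open>{i, j}\<close>. As the index type carries no order, we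
  sum over all ordered pairs and halve.\<close>

definition wedge_norm :: "real ^ 'm \<Rightarrow> real ^ 'm \<Rightarrow> real" where
  "wedge_norm x y = sqrt ((\<Sum>i\<in>UNIV. \<Sum>j\<in>UNIV. (x $ i * y $ j - x $ j * y $ i)\<^sup>2) / 2)"

lemma wedge_norm_nonneg: "wedge_norm x y \<ge> 0"
  unfolding wedge_norm_def by (auto intro!: sum_nonneg)

lemma wedge_norm_commute: "wedge_norm x y = wedge_norm y x"
  unfolding wedge_norm_def by (simp add: power2_commute mult.commute)

lemma wedge_norm_power2: "(wedge_norm x y)\<^sup>2 = (norm x * norm y)\<^sup>2 - (x \<bullet> y)\<^sup>2"
proof -
  have "(\<Sum>i\<in>UNIV. \<Sum>j\<in>UNIV. (x $ i * y $ j - x $ j * y $ i)\<^sup>2)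
      = (\<Sum>i\<in>UNIV. \<Sum>j\<in>UNIV. (x $ i * x $ i) * (y $ j * y $ j))
      + (\<Sum>i\<in>UNIV. \<Sum>j\<in>UNIV. (y $ i * y $ i) * (x $ j * x $ j))
      - 2 * (\<Sum>i\<in>UNIV. \<Sum>j\<in>UNIV. (x $ i * y $ i) * (x $ j * y $ j))"
    unfolding sum_distrib_left sum.distrib[symmetric] sum_subtractf[symmetric]
    by (intro sum.cong refl) (simp add: power2_eq_square algebra_simps)
  also have "\<dots> = 2 * ((x \<bullet> x) * (y \<bullet> y) - (x \<bullet> y) * (x \<bullet> y))"
    by (simp add: sum_product[symmetric] inner_vec_def)
  finally have "(\<Sum>i\<in>UNIV. \<Sum>j\<in>UNIV. (x $ i * y $ j - x $ j * y $ i)\<^sup>2) / 2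
      = (x \<bullet> x) * (y \<bullet> y) - (x \<bullet> y) * (x \<bullet> y)" by simp
  moreover have "(wedge_norm x y)\<^sup>2 = (\<Sum>i\<in>UNIV. \<Sum>j\<in>UNIV. (x $ i * y $ j - x $ j * y $ i)\<^sup>2) / 2"
    unfolding wedge_norm_def by (intro real_sqrt_pow2) (auto intro!: sum_nonneg)
  ultimately show ?thesis
    by (simp add: power_mult_distrib dot_square_norm power2_eq_square[of "x \<bullet> y"])
qed

lemma wedge_norm_scale_right: "wedge_norm x (c *\<^sub>R y) = \<bar>c\<bar> * wedge_norm x y"
proof -
  have "(wedge_norm x (c *\<^sub>R y))\<^sup>2 = (\<bar>c\<bar> * wedge_norm x y)\<^sup>2"
    by (simp add: wedge_norm_power2 power_mult_distrib right_diff_distrib)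
  then show ?thesis
    by (simp add: wedge_norm_nonneg)
qed

lemma wedge_norm_scale_left: "wedge_norm (c *\<^sub>R x) y = \<bar>c\<bar> * wedge_norm x y"
  by (metis wedge_norm_commute wedge_norm_scale_right)

lemma wedge_norm_le_dist:
  assumes "norm y = 1"
  shows "wedge_norm x y \<le> norm (x - t *\<^sub>R y)"
proof (rule power2_le_imp_le)
  have "y \<bullet> y = 1" using assms by (simp add: dot_square_norm)
  then have "(norm (x - t *\<^sub>R y))\<^sup>2 = x \<bullet> x - 2 * t * (x \<bullet> y) + t\<^sup>2"
    unfolding power2_norm_eq_inner
    by (simp add: inner_diff_left inner_diff_right inner_commute power2_eq_square algebra_simps)
  moreover have "(wedge_norm x y)\<^sup>2 = x \<bullet> x - (x \<bullet> y)\<^sup>2"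
    using assms by (simp add: wedge_norm_power2 dot_square_norm)
  moreover have "0 \<le> (t - x \<bullet> y)\<^sup>2" by simp
  ultimately show "(wedge_norm x y)\<^sup>2 \<le> (norm (x - t *\<^sub>R y))\<^sup>2"
    by (simp add: power2_diff algebra_simps)
qed simp

lemma wedge_norm_eq_dist:
  assumes "norm y = 1"
  shows "wedge_norm x y = norm (x - (x \<bullet> y) *\<^sub>R y)"
proof -
  have "y \<bullet> y = 1" using assms by (simp add: dot_square_norm)
  then have "(norm (x - (x \<bullet> y) *\<^sub>R y))\<^sup>2 = x \<bullet> x - (x \<bullet> y)\<^sup>2"
    unfolding power2_norm_eq_inner
    by (simp add: inner_diff_left inner_diff_right inner_commute power2_eq_square algebra_simps)
  moreover have "(wedge_norm x y)\<^sup>2 = x \<bullet> x - (x \<bullet> y)\<^sup>2"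
    using assms by (simp add: wedge_norm_power2 dot_square_norm)
  ultimately show ?thesis
    by (metis norm_ge_zero power2_eq_imp_eq wedge_norm_nonneg)
qed

lemma wedge_norm_triangle_unit:
  assumes "norm x = 1" "norm y = 1" "norm z = 1"
  shows "wedge_norm x z \<le> wedge_norm x y + wedge_norm y z"
proof -
  define a b where "a = x \<bullet> y" and "b = y \<bullet> z"
  have "\<bar>a\<bar> \<le> 1" using Cauchy_Schwarz_ineq2[of x y] assms by (simp add: a_def)
  have "wedge_norm x z \<le> norm (x - (a * b) *\<^sub>R z)"
    using assms by (intro wedge_norm_le_dist)
  also have "x - (a * b) *\<^sub>R z = (x - a *\<^sub>R y) + a *\<^sub>R (y - b *\<^sub>R z)"
    by (simp add: algebra_simps)
  also have "norm \<dots> \<le> norm (x - a *\<^sub>R y) + \<bar>a\<bar> * norm (y - b *\<^sub>R z)"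
    by (metis norm_scaleR norm_triangle_ineq)
  also have "\<dots> \<le> norm (x - a *\<^sub>R y) + norm (y - b *\<^sub>R z)"
    using \<open>\<bar>a\<bar> \<le> 1\<close> by (simp add: mult_left_le_one_le)
  finally show ?thesis
    using assms by (simp add: wedge_norm_eq_dist a_def b_def)
qed

lemma wedge_norm_normalize:
  "wedge_norm x y / (norm x * norm y) = wedge_norm (x /\<^sub>R norm x) (y /\<^sub>R norm y)"
  by (simp add: wedge_norm_scale_left wedge_norm_scale_right field_simps)

lemma wedge_norm_eq_0:
  assumes "x \<noteq> 0" "y \<noteq> 0"
  shows "wedge_norm x y = 0 \<longleftrightarrow> (\<exists>c. c \<noteq> 0 \<and> y = c *\<^sub>R x)"
proof
  assume "wedge_norm x y = 0"
  then have "wedge_norm y x = 0" by (simp add: wedge_norm_commute)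
  then have "wedge_norm y (x /\<^sub>R norm x) = 0" by (simp add: wedge_norm_scale_right)
  then have "y = (y \<bullet> (x /\<^sub>R norm x)) *\<^sub>R (x /\<^sub>R norm x)"
    using assms wedge_norm_eq_dist[of "x /\<^sub>R norm x" y] by simp
  then show "\<exists>c. c \<noteq> 0 \<and> y = c *\<^sub>R x"
    using assms by (metis scaleR_scaleR scaleR_zero_left)
next
  assume "\<exists>c. c \<noteq> 0 \<and> y = c *\<^sub>R x"
  moreover have "wedge_norm x x = 0" by (simp add: wedge_norm_def)
  ultimately show "wedge_norm x y = 0" by (auto simp: wedge_norm_scale_right)
qed

section \<open>Real projective space\<close>

definition proj_rel :: "real ^ 'm \<Rightarrow> real ^ 'm \<Rightarrow> bool" where
  "proj_rel x y \<longleftrightarrow> x \<noteq> 0 \<and> y \<noteq> 0 \<and> (\<exists>c. c \<noteq> 0 \<and> y = c *\<^sub>R x)"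

lemma part_equivp_proj_rel: "part_equivp (proj_rel :: real ^ 'm \<Rightarrow> _)"
proof (rule part_equivpI)
  have "proj_rel (1 :: real ^ 'm) 1"
    by (auto simp: proj_rel_def vec_eq_iff intro!: exI[of _ 1])
  then show "\<exists>x. proj_rel (x :: real ^ 'm) x" by blast
  show "symp (proj_rel :: real ^ 'm \<Rightarrow> _)"
  proof (rule sympI)
    fix x y :: "real ^ 'm"
    assume "proj_rel x y"
    then obtain c where "x \<noteq> 0" "y \<noteq> 0" "c \<noteq> 0" "y = c *\<^sub>R x" by (auto simp: proj_rel_def)
    then show "proj_rel y x" by (auto simp: proj_rel_def intro!: exI[of _ "inverse c"])
  qed
  show "transp (proj_rel :: real ^ 'm \<Rightarrow> _)"
  proof (rule transpI)
    fix x y z :: "real ^ 'm"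
    assume "proj_rel x y" "proj_rel y z"
    then obtain c d where "x \<noteq> 0" "z \<noteq> 0" "c \<noteq> 0" "d \<noteq> 0" "y = c *\<^sub>R x" "z = d *\<^sub>R y"
      by (auto simp: proj_rel_def)
    then show "proj_rel x z" by (auto simp: proj_rel_def intro!: exI[of _ "d * c"])
  qed
qed

text \<open>\<open>'m proj\<close> is the projective space of lines in \<open>real ^ 'm\<close>, of dimension \<open>CARD('m) - 1\<close>. The
  class of a nonzero vector \<open>x\<close> is \<open>abs_proj x\<close>; the value of \<open>abs_proj\<close> at 0 is meaningless.\<close>

quotient_type 'm proj = "real ^ 'm" / partial: proj_rel
  by (rule part_equivp_proj_rel)

instantiation proj :: (finite) metric_space
begin

lift_definition dist_proj :: "'a proj \<Rightarrow> 'a proj \<Rightarrow> real"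
  is "\<lambda>x y. wedge_norm x y / (norm x * norm y)"
  by (auto simp: proj_rel_def wedge_norm_scale_left wedge_norm_scale_right)

definition uniformity_proj :: "('a proj \<times> 'a proj) filter" where
  "uniformity_proj = (INF e\<in>{0<..}. principal {(x, y). dist x y < e})"

definition open_proj :: "'a proj set \<Rightarrow> bool" where
  "open_proj U \<longleftrightarrow> (\<forall>x\<in>U. \<forall>\<^sub>F (x', y) in uniformity. x' = x \<longrightarrow> y \<in> U)"

instance
proof
  fix \<xi> \<eta> \<zeta> :: "'a proj"
  show "dist \<xi> \<eta> = 0 \<longleftrightarrow> \<xi> = \<eta>"
    by transfer (auto simp: proj_rel_def wedge_norm_eq_0)
  have commute: "dist \<xi> \<eta> = dist \<eta> \<xi>" for \<xi> \<eta> :: "'a proj"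
    by transfer (simp add: wedge_norm_commute mult.commute)
  have "dist \<xi> \<zeta> \<le> dist \<xi> \<eta> + dist \<eta> \<zeta>" for \<xi> \<eta> \<zeta> :: "'a proj"
    by transfer
      (auto simp: proj_rel_def wedge_norm_normalize intro!: wedge_norm_triangle_unit)
  then show "dist \<xi> \<eta> \<le> dist \<xi> \<zeta> + dist \<eta> \<zeta>"
    by (metis commute)
qed (rule uniformity_proj_def open_proj_def)+

end

definition rat_independent :: "real ^ 'm::finite \<Rightarrow> bool" where
  "rat_independent x \<longleftrightarrow>
     (\<forall>q :: 'm \<Rightarrow> rat. (\<Sum>i\<in>UNIV. of_rat (q i) * x $ i) = 0 \<longrightarrow> (\<forall>i. q i = 0))"

definition li_points :: "'m::finite proj set \<Rightarrow> 'm proj set" where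
  "li_points Z = {\<xi> \<in> Z. \<exists>x. x \<noteq> 0 \<and> \<xi> = abs_proj x \<and> rat_independent x}"

section \<open>Uniform exponents of approximation\<close>

lift_definition approx_dist :: "'m::finite proj \<Rightarrow> real ^ 'm \<Rightarrow> real"
  is "\<lambda>\<xi> x. wedge_norm x \<xi> / norm \<xi>"
  by (auto simp: proj_rel_def wedge_norm_scale_right)

definition int_points :: "real \<Rightarrow> (real ^ 'm) set" where
  "int_points X = {x. (\<forall>i. x $ i \<in> \<int>) \<and> x \<noteq> 0 \<and> norm x \<le> X}"

lemma finite_int_points: "finite (int_points X :: (real ^ 'm) set)"
proof -
  define S :: "real set" where "S = {t \<in> \<int>. \<bar>t\<bar> \<le> X}"
  have "int_points X \<subseteq> vec_lambda ` {f :: 'm \<Rightarrow> real. \<forall>i. f i \<in> S}"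
  proof
    fix x :: "real ^ 'm" assume "x \<in> int_points X"
    then have "x $ i \<in> S" for i
      using component_le_norm_cart[of x i] by (auto simp: S_def int_points_def)
    then show "x \<in> vec_lambda ` {f. \<forall>i. f i \<in> S}"
      by (intro image_eqI[of _ _ "vec_nth x"]) auto
  qed
  moreover have "finite S"
    unfolding S_def by (rule finite_abs_int_segment)
  then have "finite {f :: 'm \<Rightarrow> real. \<forall>i. f i \<in> S}"
    using finite_PiE[of "UNIV :: 'm set" "\<lambda>_. S"] by (simp add: PiE_def Pi_def extensional_def)
  ultimately show ?thesis by (meson finite_imageI finite_subset)
qed

lemma int_points_nonempty:
  assumes "X \<ge> 1"
  shows "(int_points X :: (real ^ 'm) set) \<noteq> {}"
proof -
  have "axis undefined 1 \<in> (int_points X :: (real ^ 'm) set)"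
    using assms by (auto simp: int_points_def axis_def vec_eq_iff norm_axis_1[unfolded axis_def])
  then show ?thesis by blast
qed

text \<open>By the two preceding lemmas this is a genuine minimum for \<open>X \<ge> 1\<close>.\<close>

definition min_approx_dist :: "'m::finite proj \<Rightarrow> real \<Rightarrow> real" where
  "min_approx_dist \<xi> X = Min (approx_dist \<xi> ` int_points X)"

text \<open>The exponents are extended reals: the supremum is infinite for instance when \<open>\<xi>\<close> is a rational
  point.\<close>

definition unif_exponent :: "'m::finite proj \<Rightarrow> ereal" where
  "unif_exponent \<xi> =
     Sup (ereal ` {l. \<forall>\<^sub>F X in at_top. min_approx_dist \<xi> X \<le> X powr (- l)})"

definition unif_exponent_set :: "'m::finite proj set \<Rightarrow> ereal" where
  "unif_exponent_set Z = (SUP \<xi>\<in>li_points Z. unif_exponent \<xi>)"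

section \<open>Multilinear maps\<close>

text \<open>A \<open>k\<close>-tuple of vectors is a function on an index type \<open>'k\<close> with \<open>k\<close> elements.\<close>

definition multilinear :: "(('k \<Rightarrow> 'a :: real_vector) \<Rightarrow> 'b :: real_vector) \<Rightarrow> bool" where
  "multilinear \<phi> \<longleftrightarrow> (\<forall>x i. linear (\<lambda>v. \<phi> (x(i := v))))"

definition rat_vecs :: "(real ^ 'n) set" where
  "rat_vecs = {x. \<forall>i. x $ i \<in> \<rat>}"

definition rat_tuples :: "('k \<Rightarrow> real ^ 'n) set" where
  "rat_tuples = {x. \<forall>i. x i \<in> rat_vecs}"

definition defined_over_rat :: "(('k \<Rightarrow> real ^ 'n) \<Rightarrow> real ^ 'm) \<Rightarrow> bool" where
  "defined_over_rat \<phi> \<longleftrightarrow> \<phi> ` rat_tuples \<subseteq> rat_vecs"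

definition projectivization :: "(real ^ 'm::finite) set \<Rightarrow> 'm proj set" where
  "projectivization S = abs_proj ` (S - {0})"

end

theory Submission
  imports Defs "HOL-Real_Asymp.Real_Asymp"
begin

text \<open>Moving one argument of \<open>\<phi>\<close> at a time by \<open>v / M\<close>, with \<open>v\<close> rational and \<open>M\<close> a huge integer,
  gives integer points \<open>x\<^sub>0, x\<^sub>1, \<dots>\<close> proportional to values of \<open>\<phi>\<close>, where \<open>\<parallel>x\<^sub>i\<^sub>+\<^sub>1\<parallel>\<close> and the
  inverse of the distance from \<open>[x\<^sub>i]\<close> to \<open>[x\<^sub>i\<^sub>+\<^sub>1]\<close> both grow linearly in \<open>M\<close>. Hence the limit \<open>\<xi>\<close> satisfies
  \<open>D\<^sub>\<xi>(x\<^sub>i) \<le> \<parallel>x\<^sub>i\<^sub>+\<^sub>1\<parallel>\<close> to the power \<open>- (1 - 1 / (i + 1))\<close>, and its exponent is at least 1. As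
  \<open>\<phi>\<close> is not contained in any rational hyperplane, every rational linear form can be made nonzero
  in finitely many steps and kept so by staying in small nested balls; in the same way any given
  sequence of points with rationally independent coordinates is avoided, since the \<open>[x\<^sub>i]\<close> are
  rational. Conversely, an exponent above 1 would force the integer points realizing the minimum to
  be eventually parallel, so that \<open>\<xi>\<close> would be rational.\<close>

section \<open>Points of projective space\<close>

lemma proj_rel_refl: "x \<noteq> 0 \<Longrightarrow> proj_rel x x"
  by (auto simp: proj_rel_def intro: exI[of _ 1])

lemma dist_abs_proj:
  assumes "x \<noteq> 0" "y \<noteq> 0"
  shows "dist (abs_proj x) (abs_proj y) = wedge_norm x y / (norm x * norm y)"
  using assms by (simp add: dist_proj.abs_eq proj_rel_refl)

lemma approx_dist_abs_proj:
  assumes "u \<noteq> 0"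
  shows "approx_dist (abs_proj u) x = wedge_norm x u / norm u"
  using assms by (simp add: approx_dist.abs_eq proj_rel_refl)

lemma abs_proj_eqD:
  assumes "x \<noteq> 0" "y \<noteq> 0" "abs_proj x = abs_proj y"
  shows "y \<in> span {x}"
proof -
  have "wedge_norm x y = 0"
    using dist_abs_proj[OF assms(1,2)] assms by simp
  then show ?thesis
    using assms by (auto simp: wedge_norm_eq_0 span_singleton)
qed

text \<open>For nonzero \<open>x\<close>, dividing by \<open>norm x\<close> turns the left side into
  the distance from \<open>u\<close> to the line through \<open>x\<close>, and \<open>x\<close> is
  itself a point of that line.\<close>

lemma wedge_norm_le_mult: "wedge_norm x u \<le> norm x * norm (u - x)"
proof (cases "x = 0")
  case True
  then show ?thesis by (simp add: wedge_norm_def)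
next
  case False
  have "wedge_norm u (x /\<^sub>R norm x) \<le> norm (u - norm x *\<^sub>R (x /\<^sub>R norm x))"
    using False by (intro wedge_norm_le_dist) simp
  then show ?thesis
    using False by (simp add: wedge_norm_scale_right wedge_norm_commute[of u] field_simps)
qed

text \<open>This is the triangle inequality for the projective distance, multiplied by
  \<open>norm x * norm y\<close>. It shows that two short vectors both close to the line of
  \<open>u\<close> have a small wedge product.\<close>

lemma wedge_norm_triangle:
  assumes "x \<noteq> 0" "y \<noteq> 0" "u \<noteq> 0"
  shows "wedge_norm x y \<le> norm y * (wedge_norm x u / norm u) + norm x * (wedge_norm y u / norm u)"
proof -
  have "wedge_norm x y / (norm x * norm y)
      \<le> wedge_norm x u / (norm x * norm u) + wedge_norm u y / (norm u * norm y)"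
    unfolding wedge_norm_normalize using assms by (intro wedge_norm_triangle_unit) simp_all
  then show ?thesis
    using assms by (simp add: field_simps wedge_norm_commute[of u y])
qed

section \<open>Integral and rational vectors\<close>

definition int_vecs :: "(real ^ 'm) set" where
  "int_vecs = {x. \<forall>i. x $ i \<in> \<int>}"

lemma int_vecs_add: "x \<in> int_vecs \<Longrightarrow> y \<in> int_vecs \<Longrightarrow> x + y \<in> int_vecs"
  by (simp add: int_vecs_def)

lemma int_vecs_scaleR: "x \<in> int_vecs \<Longrightarrow> real n *\<^sub>R x \<in> int_vecs"
  by (simp add: int_vecs_def)

lemma int_vecs_norm_ge_1:
  fixes x :: "real ^ 'm"
  assumes "x \<in> int_vecs" "x \<noteq> 0"
  shows "norm x \<ge> 1"
proof -
  obtain i where "x $ i \<noteq> 0" using assms by (auto simp: vec_eq_iff)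
  then have "1 \<le> \<bar>x $ i\<bar>"
    using assms by (auto simp: int_vecs_def intro: Ints_nonzero_abs_ge1)
  then show ?thesis
    using component_le_norm_cart[of x i] by simp
qed

text \<open>The minors of integral vectors are integers, so a single nonzero one already pushes the
  sum of squares up to 1 and the norm above \<open>1 / 2\<close>.\<close>

lemma wedge_norm_int_vecs_eq_0:
  fixes x y :: "real ^ 'm"
  assumes "x \<in> int_vecs" "y \<in> int_vecs" "wedge_norm x y < 1 / 2"
  shows "wedge_norm x y = 0"
proof -
  let ?d = "\<lambda>i j. x $ i * y $ j - x $ j * y $ i"
  let ?S = "\<Sum>i\<in>UNIV. \<Sum>j\<in>UNIV. (?d i j)\<^sup>2"
  have "sqrt (?S / 2) < sqrt (1 / 4)"
    using assms(3) by (simp add: wedge_norm_def real_sqrt_divide)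
  then have S: "?S < 1" by simp
  have "?d i j = 0" for i j
  proof (rule ccontr)
    assume "?d i j \<noteq> 0"
    moreover have "?d i j \<in> \<int>" using assms by (simp add: int_vecs_def)
    ultimately have "1 \<le> \<bar>?d i j\<bar>" by (rule Ints_nonzero_abs_ge1[rotated])
    then have "1 \<le> (?d i j)\<^sup>2" by (metis one_le_power power2_abs)
    also have "\<dots> \<le> (\<Sum>j\<in>UNIV. (?d i j)\<^sup>2)"
      by (rule member_le_sum) auto
    also have "\<dots> \<le> ?S"
      by (rule member_le_sum[where f = "\<lambda>i. \<Sum>j\<in>UNIV. (?d i j)\<^sup>2"]) (auto intro!: sum_nonneg)
    finally show False using S by simp
  qed
  then show ?thesis by (simp add: wedge_norm_def)
qed

lemma rat_vecs_scaleR: "x \<in> rat_vecs \<Longrightarrow> c \<in> \<rat> \<Longrightarrow> c *\<^sub>R x \<in> rat_vecs"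
  by (simp add: rat_vecs_def)

lemma rat_vecs_add: "x \<in> rat_vecs \<Longrightarrow> y \<in> rat_vecs \<Longrightarrow> x + y \<in> rat_vecs"
  by (simp add: rat_vecs_def)

lemma int_vecs_imp_rat_vecs: "x \<in> int_vecs \<Longrightarrow> x \<in> rat_vecs"
  using Ints_subset_Rats by (auto simp: int_vecs_def rat_vecs_def)

lemma rat_tuples_upd: "y \<in> rat_tuples \<Longrightarrow> v \<in> rat_vecs \<Longrightarrow> y(j := v) \<in> rat_tuples"
  by (simp add: rat_tuples_def)

lemma rat_vecs_denominator:
  fixes x :: "real ^ 'm::finite"
  assumes "x \<in> rat_vecs"
  obtains d :: nat where "d > 0" "real d *\<^sub>R x \<in> int_vecs"
proof -
  have "\<exists>d::nat. d > 0 \<and> real d * x $ i \<in> \<int>" for i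
  proof -
    obtain a b :: int where "b > 0" "x $ i = of_int a / of_int b"
      using assms by (metis Rats_cases' mem_Collect_eq rat_vecs_def)
    then show ?thesis by (intro exI[of _ "nat b"]) simp
  qed
  then obtain d :: "'m \<Rightarrow> nat" where d: "\<And>i. d i > 0" "\<And>i. real (d i) * x $ i \<in> \<int>"
    by metis
  have "real (\<Prod>i\<in>UNIV. d i) * x $ i \<in> \<int>" for i
  proof -
    have "real (\<Prod>i\<in>UNIV. d i) * x $ i = real (\<Prod>i\<in>UNIV - {i}. d i) * (real (d i) * x $ i)"
      using prod.remove[of UNIV i d] by (simp add: mult_ac)
    then show ?thesis using d(2)[of i] Ints_mult[OF Ints_of_nat] by metis
  qed
  then show ?thesis
    using d(1) by (intro that[of "\<Prod>i\<in>UNIV. d i"]) (auto simp: int_vecs_def prod_pos)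
qed

lemma countable_rat_vecs: "countable (rat_vecs :: (real ^ 'm::finite) set)"
proof -
  have "rat_vecs \<subseteq> range (\<lambda>q :: 'm \<Rightarrow> rat. \<chi> i. of_rat (q i))"
  proof
    fix x :: "real ^ 'm" assume "x \<in> rat_vecs"
    then have "\<forall>i. \<exists>q. x $ i = of_rat q"
      by (auto simp: rat_vecs_def Rats_def)
    then obtain q where "\<forall>i. x $ i = of_rat (q i)" by metis
    then show "x \<in> range (\<lambda>q :: 'm \<Rightarrow> rat. \<chi> i. of_rat (q i))"
      by (intro image_eqI[of _ _ q]) (auto simp: vec_eq_iff)
  qed
  then show ?thesis by (rule countable_subset) simp
qed

lemma rat_independentI:
  fixes u :: "real ^ 'm::finite"
  assumes "\<And>l. l \<in> rat_vecs \<Longrightarrow> l \<noteq> 0 \<Longrightarrow> l \<bullet> u \<noteq> 0"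
  shows "rat_independent u"
  unfolding rat_independent_def
proof (intro allI impI)
  fix q :: "'m \<Rightarrow> rat" and i
  assume "(\<Sum>i\<in>UNIV. of_rat (q i) * u $ i) = 0"
  then have "((\<chi> i. of_rat (q i)) :: real ^ 'm) \<bullet> u = 0" by (simp add: inner_vec_def)
  moreover have "((\<chi> i. of_rat (q i)) :: real ^ 'm) \<in> rat_vecs" by (simp add: rat_vecs_def)
  ultimately have "((\<chi> i. of_rat (q i)) :: real ^ 'm) = 0" using assms by blast
  then show "q i = 0" by (simp add: vec_eq_iff)
qed

text \<open>Proportionality makes every minor \<open>x $ i * u $ j - x $ j * u $ i\<close> vanish.
  If \<open>x $ i\<close> is nonzero and \<open>j\<close> differs from \<open>i\<close>, this is a
  nontrivial rational relation between the coordinates of \<open>u\<close>.\<close>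

lemma rat_independent_not_rational:
  fixes u x :: "real ^ 'm::finite"
  assumes "CARD('m) \<ge> 2" "rat_independent u" "x \<in> rat_vecs" "x \<noteq> 0"
  shows "x \<notin> span {u}"
proof
  assume "x \<in> span {u}"
  then obtain c where c: "x = c *\<^sub>R u" by (auto simp: span_singleton)
  obtain i where i: "x $ i \<noteq> 0" using assms(4) by (auto simp: vec_eq_iff)
  have "UNIV \<noteq> {i}" using assms(1) by (metis card_1_singleton_iff numeral_le_one_iff semiring_norm(69) One_nat_def)
  then obtain j where j: "j \<noteq> i" by auto
  obtain a b where a: "x $ i = of_rat a" and b: "x $ j = of_rat b"
    using assms(3) by (auto simp: rat_vecs_def elim: Rats_cases)
      (metis Rats_cases)
  define q where "q = (\<lambda>s. if s = j then a else if s = i then - b else 0)"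
  have "(\<Sum>s\<in>UNIV. of_rat (q s) * u $ s)
      = (\<Sum>s\<in>UNIV. (if s = j then of_rat a * u $ s else 0) + (if s = i then - of_rat b * u $ s else 0))"
    using j by (intro sum.cong) (auto simp: q_def of_rat_minus)
  also have "\<dots> = of_rat a * u $ j - of_rat b * u $ i"
    by (simp add: sum.distrib)
  also have "\<dots> = 0"
    by (simp add: c flip: a b)
  finally have "q j = 0"
    using assms(2) unfolding rat_independent_def by blast
  then show False using a i by (simp add: q_def)
qed

section \<open>The uniform exponent is at most one\<close>

lemma min_approx_dist_attained:
  assumes "X \<ge> 1"
  obtains x where "x \<in> int_points X" "min_approx_dist \<xi> X = approx_dist \<xi> x"
proof -
  have "min_approx_dist \<xi> X \<in> approx_dist \<xi> ` int_points X"
    unfolding min_approx_dist_def using assms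
    by (intro Min_in) (auto simp: finite_int_points int_points_nonempty)
  then show ?thesis using that by blast
qed

lemma min_approx_dist_le:
  assumes "x \<in> int_points X"
  shows "min_approx_dist \<xi> X \<le> approx_dist \<xi> x"
  unfolding min_approx_dist_def using assms by (intro Min_le) (auto simp: finite_int_points)

text \<open>An admissible \<open>l > 1\<close> gives points \<open>x n\<close> attaining the minimum
  for \<open>X = n\<close> whose consecutive wedge products tend to 0, hence eventually vanish by
  integrality. All later \<open>x n\<close> then lie on one rational line, which must be the line of
  \<open>u\<close>.\<close>

lemma unif_exponent_le_1:
  fixes u :: "real ^ 'm::finite"
  assumes "CARD('m) \<ge> 2" "rat_independent u" "u \<noteq> 0"
  shows "unif_exponent (abs_proj u) \<le> 1"
proof -
  have "l \<le> 1" if ev: "\<forall>\<^sub>F X in at_top. min_approx_dist (abs_proj u) X \<le> X powr - l" for l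
  proof (rule ccontr)
    assume "\<not> l \<le> 1"
    then have l: "l > 1" by simp
    define D where "D x = wedge_norm x u / norm u" for x
    \<comment> \<open>This expression will bound the wedge product of \<open>x n\<close> and
      \<open>x (Suc n)\<close>.\<close>
    have "((\<lambda>n. real (Suc n) * real n powr - l + real n * real (Suc n) powr - l) \<longlonglongrightarrow> 0)"
      using l by real_asymp
    then have "\<forall>\<^sub>F n in sequentially. real (Suc n) * real n powr - l + real n * real (Suc n) powr - l < 1 / 2"
      by (rule order_tendstoD) simp
    moreover have "\<forall>\<^sub>F n in sequentially. min_approx_dist (abs_proj u) (real n) \<le> real n powr - l"
      using ev filterlim_real_sequentially by (auto simp: filterlim_iff)
    ultimately have "\<forall>\<^sub>F n in sequentially. n \<ge> 1 \<and>
        real (Suc n) * real n powr - l + real n * real (Suc n) powr - l < 1 / 2 \<and>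
        min_approx_dist (abs_proj u) (real n) \<le> real n powr - l"
      using eventually_ge_at_top[of 1] by eventually_elim auto
    then obtain n0 where n0: "\<And>n. n \<ge> n0 \<Longrightarrow> n \<ge> 1 \<and>
        real (Suc n) * real n powr - l + real n * real (Suc n) powr - l < 1 / 2 \<and>
        min_approx_dist (abs_proj u) (real n) \<le> real n powr - l"
      by (auto simp: eventually_sequentially)
    have "\<exists>x. x \<in> int_points (real n) \<and> D x \<le> real n powr - l" if n: "n \<ge> n0" for n
    proof -
      obtain x where "x \<in> int_points (real n)" "min_approx_dist (abs_proj u) (real n) = approx_dist (abs_proj u) x"
        using min_approx_dist_attained[of "real n" "abs_proj u"] n0[OF n] by auto
      then show ?thesis
        using n0[OF n] assms(3) by (auto simp: D_def approx_dist_abs_proj)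
    qed
    then obtain x where x: "\<And>n. n \<ge> n0 \<Longrightarrow> x n \<in> int_points (real n) \<and> D (x n) \<le> real n powr - l"
      by metis
    have x_int: "x n \<in> int_vecs" "x n \<noteq> 0" "norm (x n) \<le> real n" if "n \<ge> n0" for n
      using x[OF that] by (auto simp: int_points_def int_vecs_def)
    have par: "x (Suc n) \<in> span {x n}" if n: "n \<ge> n0" for n
    proof -
      have "wedge_norm (x n) (x (Suc n)) \<le> norm (x (Suc n)) * D (x n) + norm (x n) * D (x (Suc n))"
        unfolding D_def using x_int n assms(3) by (intro wedge_norm_triangle) auto
      also have "\<dots> \<le> real (Suc n) * real n powr - l + real n * real (Suc n) powr - l"
        using x[of n] x[of "Suc n"] x_int[of n] x_int[of "Suc n"] n
        by (intro add_mono mult_mono) (auto simp: D_def wedge_norm_nonneg)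
      also have "\<dots> < 1 / 2" using n0[OF n] by blast
      finally have "wedge_norm (x n) (x (Suc n)) = 0"
        using x_int n by (intro wedge_norm_int_vecs_eq_0) auto
      then show ?thesis
        using x_int n by (auto simp: wedge_norm_eq_0 span_singleton)
    qed
    define v where "v = x n0"
    have v: "v \<in> int_vecs" "v \<noteq> 0" using x_int by (auto simp: v_def)
    have xv: "x n \<in> span {v}" if "n \<ge> n0" for n
      using that
    proof (induction n rule: dec_induct)
      case base
      then show ?case by (simp add: v_def span_base)
    next
      case (step n)
      then show ?case using par[of n] by (auto simp: span_singleton)
    qed
    \<comment> \<open>The multiples \<open>x n\<close> of \<open>v\<close> are nonzero and integral,
      so they cannot shrink to 0 and make \<open>D (x n)\<close> small for that reason.\<close>
    have "D v / norm v \<le> real n powr - l" if n: "n \<ge> n0" for n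
    proof -
      obtain c where c: "x n = c *\<^sub>R v" using xv[OF n] by (auto simp: span_singleton)
      have "1 \<le> \<bar>c\<bar> * norm v"
        using int_vecs_norm_ge_1[of "x n"] x_int[OF n] by (simp add: c)
      then have "1 * (D v / norm v) \<le> (\<bar>c\<bar> * norm v) * (D v / norm v)"
        by (intro mult_right_mono) (auto simp: D_def wedge_norm_nonneg)
      also have "\<dots> = D (x n)"
        using v by (simp add: c D_def wedge_norm_scale_left)
      finally show ?thesis using x[OF n] by simp
    qed
    moreover have "(\<lambda>n. real n powr - l) \<longlonglongrightarrow> 0" using l by real_asymp
    ultimately have "D v / norm v \<le> 0"
      by (intro LIMSEQ_le_const) auto
    then have "wedge_norm u v = 0"
      using v assms(3) wedge_norm_nonneg[of v u]
      by (simp add: D_def field_simps wedge_norm_commute[of u v] mult_le_0_iff)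
    then have "v \<in> span {u}"
      using v assms(3) by (auto simp: wedge_norm_eq_0 span_singleton)
    then show False
      using rat_independent_not_rational assms v int_vecs_imp_rat_vecs by blast
  qed
  then show ?thesis
    unfolding unif_exponent_def by (auto intro!: Sup_least)
qed

section \<open>Perturbing one argument\<close>

lemma multilinear_perturb:
  assumes "multilinear \<phi>"
  shows "\<phi> (y(j := y j + t *\<^sub>R v)) = \<phi> y + t *\<^sub>R \<phi> (y(j := v))"
proof -
  have "linear (\<lambda>v. \<phi> (y(j := v)))" using assms by (simp add: multilinear_def)
  from linear_add[OF this, of "y j" "t *\<^sub>R v"] linear_scale[OF this, of t v]
  show ?thesis by simp
qed

text \<open>One step of the construction: argument \<open>j\<close> of \<open>y\<close> moves by
  \<open>z j / M\<close> for a large integer \<open>M\<close>. The tuple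
  \<open>override_on z y J\<close> agrees with \<open>y\<close> on \<open>J\<close> and with
  \<open>z\<close> elsewhere. Enlarging \<open>J\<close> one index at a time carries the
  nonvanishing of \<open>l\<close> from \<open>\<phi> z\<close> to the value of
  \<open>\<phi>\<close> at the moved tuple.\<close>

lemma perturbation_step:
  fixes \<phi> :: "('k \<Rightarrow> real ^ 'n) \<Rightarrow> real ^ 'm::finite"
  assumes \<phi>: "multilinear \<phi>" "defined_over_rat \<phi>"
    and y: "y \<in> rat_tuples" and z: "z \<in> rat_tuples"
    and N: "N > 0" "real N *\<^sub>R \<phi> y \<in> int_vecs"
    and r: "0 < r" "r < norm (\<phi> y) / 2"
    and \<epsilon>: "0 < \<epsilon>" "\<epsilon> \<le> 1"
    and j: "j \<notin> J" and l: "l \<bullet> \<phi> (override_on z y J) \<noteq> 0"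
    and E: "closed E" "\<And>x. x \<in> rat_vecs \<Longrightarrow> x \<noteq> 0 \<Longrightarrow> x \<notin> E"
  shows "\<exists>y' N' r'. y' \<in> rat_tuples \<and> N' > 0 \<and> real N' *\<^sub>R \<phi> y' \<in> int_vecs \<and>
    0 < r' \<and> r' < norm (\<phi> y') / 2 \<and> B \<le> norm (real N' *\<^sub>R \<phi> y') \<and>
    l \<bullet> \<phi> (override_on z y' (insert j J)) \<noteq> 0 \<and>
    cball (\<phi> y') r' \<subseteq> cball (\<phi> y) r \<and>
    (\<forall>u\<in>cball (\<phi> y') r'. u \<notin> E \<and> (l \<bullet> \<phi> y' \<noteq> 0 \<longrightarrow> l \<bullet> u \<noteq> 0) \<and>
      wedge_norm (real N *\<^sub>R \<phi> y) u / norm u \<le> norm (real N' *\<^sub>R \<phi> y') powr (\<epsilon> - 1))"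
proof -
  define w v a where "w = \<phi> y" and "v = z j" and "a = \<phi> (y(j := z j))"
  have v: "v \<in> rat_vecs" using z by (simp add: v_def rat_tuples_def)
  have "a \<in> rat_vecs"
    using \<phi>(2) rat_tuples_upd[OF y v] by (auto simp: a_def v_def defined_over_rat_def)
  \<comment> \<open>Clearing the denominators of \<open>a\<close> once makes
    \<open>N * M * d\<close> a denominator of \<open>w + a / M\<close> that is only linear in
    \<open>M\<close>.\<close>
  then obtain d :: nat where d: "d > 0" "real d *\<^sub>R a \<in> int_vecs" by (rule rat_vecs_denominator)
  have w0: "norm w > 0" using r unfolding w_def by linarith
  define yM where "yM M = y(j := y j + (1 / real M) *\<^sub>R v)" for M :: nat
  define wM where "wM M = w + (1 / real M) *\<^sub>R a" for M :: nat
  have \<phi>_yM: "\<phi> (yM M) = wM M" for M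
    unfolding yM_def wM_def w_def a_def using multilinear_perturb[OF \<phi>(1)] by (simp add: v_def)
  \<comment> \<open>The form takes the value \<open>\<alpha> + \<beta> / M\<close> at the new mixed
    tuple. As \<open>\<beta>\<close> is nonzero by hypothesis, this is nonzero for large
    \<open>M\<close>, whether or not \<open>\<alpha>\<close> is 0.\<close>
  define \<alpha> \<beta> where "\<alpha> = l \<bullet> \<phi> (override_on z y (insert j J))"
    and "\<beta> = l \<bullet> \<phi> (override_on z y J)"
  have l_yM: "l \<bullet> \<phi> (override_on z (yM M) (insert j J)) = \<alpha> + \<beta> / real M" for M
  proof -
    let ?o = "override_on z y (insert j J)"
    have "override_on z (yM M) (insert j J) = ?o(j := ?o j + (1 / real M) *\<^sub>R v)"
      by (auto simp: yM_def override_on_def fun_eq_iff)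
    moreover have "?o(j := v) = override_on z y J"
      using j by (auto simp: override_on_def fun_eq_iff v_def)
    ultimately show ?thesis
      using multilinear_perturb[OF \<phi>(1), of ?o j "1 / real M" v]
      by (simp add: \<alpha>_def \<beta>_def inner_add_right)
  qed
  define NM where "NM M = N * M * d" for M
  have lim: "wM \<longlonglongrightarrow> w"
    unfolding wM_def by (intro tendsto_eq_intros lim_const_over_n | simp)+
  have ev1: "\<forall>\<^sub>F M in sequentially. wM M \<in> ball w r"
    using lim r(1) by (intro topological_tendstoD) auto
  have ev2: "\<forall>\<^sub>F M in sequentially. norm (wM M) > norm w / 2"
    using lim w0 by (intro order_tendstoD(1)[OF tendsto_norm]) auto
  have ev3: "\<forall>\<^sub>F M in sequentially. B \<le> real M * (norm w / 2)"
    using w0 by real_asymp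
  have ev4: "\<forall>\<^sub>F M in sequentially. \<alpha> + \<beta> / real M \<noteq> 0"
  proof (cases "\<alpha> = 0")
    case True
    then show ?thesis
      using l eventually_gt_at_top[of 0] by (auto simp: \<beta>_def elim: eventually_mono)
  next
    case False
    have "(\<lambda>M. \<alpha> + \<beta> / real M) \<longlonglongrightarrow> \<alpha>" by real_asymp
    then show ?thesis using False by (rule tendsto_imp_eventually_ne)
  qed
  \<comment> \<open>\<open>C / M\<close> will bound the approximation error of the old integer
    point, and \<open>C' * M\<close> the norm of the new one. The gain \<open>\<epsilon> > 0\<close>
    in the exponent absorbs both constants.\<close>
  define C C' where "C = 2 * real N * (norm a + 1)" and "C' = real N * real d * (norm w + norm a)"
  have C: "C > 0" using N by (simp add: C_def add_nonneg_pos)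
  have C': "C' > 0" using N d w0 by (simp add: C'_def add_pos_nonneg)
  have ev5: "\<forall>\<^sub>F M in sequentially. C / real M \<le> (C' * real M) powr (\<epsilon> - 1)"
    using C C' \<epsilon> by real_asymp
  obtain M where M: "M > 0" "wM M \<in> ball w r" "norm (wM M) > norm w / 2" "B \<le> real M * (norm w / 2)"
    "\<alpha> + \<beta> / real M \<noteq> 0" "C / real M \<le> (C' * real M) powr (\<epsilon> - 1)"
    using eventually_happens'[OF sequentially_bot eventually_conj[OF eventually_gt_at_top[of 0]
        eventually_conj[OF ev1 eventually_conj[OF ev2 eventually_conj[OF ev3 eventually_conj[OF ev4 ev5]]]]]]
    by blast
  have y': "yM M \<in> rat_tuples"
    unfolding yM_def using y v
    by (intro rat_tuples_upd rat_vecs_add rat_vecs_scaleR) (auto simp: rat_tuples_def)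
  have N': "NM M > 0" using N d M by (simp add: NM_def)
  have "real (NM M) *\<^sub>R wM M = real (M * d) *\<^sub>R (real N *\<^sub>R w) + real N *\<^sub>R (real d *\<^sub>R a)"
    using M(1) by (simp add: NM_def wM_def scaleR_add_right mult_ac)
  then have int': "real (NM M) *\<^sub>R wM M \<in> int_vecs"
    using N(2) d(2) by (simp only: w_def int_vecs_add int_vecs_scaleR)
  have norm_ge: "B \<le> norm (real (NM M) *\<^sub>R wM M)"
  proof -
    have "real M * 1 \<le> real M * (real N * real d)"
      using N d by (intro mult_left_mono) (simp_all flip: of_nat_mult)
    then have "real M * (norm w / 2) \<le> real (NM M) * norm (wM M)"
      using M(3) w0 by (intro mult_mono) (auto simp: NM_def mult_ac)
    then show ?thesis using M(4) by simp
  qed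
  have norm_le: "norm (real (NM M) *\<^sub>R wM M) \<le> C' * real M"
  proof -
    have "norm (wM M) \<le> norm w + (1 / real M) * norm a"
      unfolding wM_def by (rule norm_triangle_le) simp
    also have "\<dots> \<le> norm w + 1 * norm a"
      using M(1) by (intro add_left_mono mult_right_mono) auto
    finally have "real (NM M) * norm (wM M) \<le> real (NM M) * (norm w + norm a)"
      by (intro mult_left_mono) auto
    then show ?thesis by (simp add: NM_def C'_def mult_ac)
  qed
  have wM0: "wM M \<noteq> 0" using M(3) w0 by auto
  \<comment> \<open>An open set of admissible limits. The centre \<open>wM M\<close> avoids
    \<open>E\<close> because it is rational and nonzero; the case distinction keeps it in
    \<open>U\<close> even if \<open>l\<close> vanishes there.\<close>
  define U where "U = ball w r \<inter> ball (wM M) (1 / real M) \<inter> - E \<inter>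
    (if l \<bullet> wM M \<noteq> 0 then - {u. l \<bullet> u = 0} else UNIV)"
  have "open U"
    unfolding U_def using E(1) closed_hyperplane[of l 0] by (auto intro!: open_Int simp flip: closed_def)
  moreover have "wM M \<in> U"
  proof -
    have "wM M \<in> rat_vecs"
      using \<phi>(2) y' \<phi>_yM[of M] by (auto simp: defined_over_rat_def)
    then show ?thesis using M wM0 E(2) by (auto simp: U_def)
  qed
  ultimately obtain s where s: "s > 0" "cball (wM M) s \<subseteq> U"
    using open_contains_cball by blast
  define r' where "r' = min s (norm (wM M) / 4)"
  have r': "0 < r'" "cball (wM M) r' \<subseteq> U"
    using s wM0 by (auto simp: r'_def)
  have "r' \<le> norm (wM M) / 4" by (simp add: r'_def)
  then have r'_less: "r' < norm (wM M) / 2" using M(3) w0 by linarith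
  have "wedge_norm (real N *\<^sub>R w) u / norm u \<le> norm (real (NM M) *\<^sub>R wM M) powr (\<epsilon> - 1)"
    if "u \<in> U" for u
  proof -
    have "norm (u - w) < r" "norm (u - wM M) < 1 / real M"
      using that by (auto simp: U_def dist_norm norm_minus_commute)
    have "norm w \<le> norm u + norm (u - w)"
      by (metis norm_minus_commute norm_triangle_sub)
    \<comment> \<open>The bound \<open>r < norm w / 2\<close> keeps the ball away from 0.\<close>
    then have u: "norm u \<ge> norm w / 2"
      using \<open>norm (u - w) < r\<close> r(2) unfolding w_def[symmetric] by linarith
    have "norm (u - w) \<le> norm (u - wM M) + norm ((1 / real M) *\<^sub>R a)"
      using norm_triangle_ineq[of "u - wM M" "(1 / real M) *\<^sub>R a"] by (simp add: wM_def)
    then have "norm (u - w) \<le> (norm a + 1) / real M"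
      using \<open>norm (u - wM M) < 1 / real M\<close> by (simp add: add_divide_distrib)
    then have "norm w * norm (u - w) \<le> norm w * ((norm a + 1) / real M)"
      by (intro mult_left_mono) auto
    then have "wedge_norm w u \<le> norm w * ((norm a + 1) / real M)"
      using wedge_norm_le_mult[of w u] by linarith
    then have "real N * wedge_norm w u / norm u
        \<le> real N * (norm w * ((norm a + 1) / real M)) / (norm w / 2)"
      using u w0 by (intro frac_le mult_left_mono) (auto intro!: mult_nonneg_nonneg divide_nonneg_nonneg)
    also have "\<dots> = C / real M"
      using w0 M(1) by (simp add: C_def divide_simps)
    also have "\<dots> \<le> (C' * real M) powr (\<epsilon> - 1)" by (rule M(6))
    \<comment> \<open>The exponent is at most 0, so the upper bound on the norm reverses.\<close>
    also have "\<dots> \<le> norm (real (NM M) *\<^sub>R wM M) powr (\<epsilon> - 1)"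
      using norm_le wM0 N' \<epsilon> by (intro powr_mono2') auto
    finally show ?thesis by (simp add: wedge_norm_scale_left)
  qed
  moreover have "u \<notin> E \<and> (l \<bullet> wM M \<noteq> 0 \<longrightarrow> l \<bullet> u \<noteq> 0) \<and> u \<in> cball w r" if "u \<in> U" for u
    using that by (auto simp: U_def split: if_splits)
  ultimately show ?thesis
    using y' N' int' norm_ge r' r'_less l_yM[of M] M(5)
    by (intro exI[of _ "yM M"] exI[of _ "NM M"] exI[of _ r']) (auto simp: \<phi>_yM w_def[symmetric] subset_iff)
qed

section \<open>Construction of the points\<close>

text \<open>The \<open>e i\<close> span the lines to be avoided, which is what later yields
  uncountability. Each is closed and contains no nonzero rational vector, so it can serve as
  \<open>E\<close> in \<open>perturbation_step\<close>.\<close>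

lemma exists_well_approximable_point:
  fixes \<phi> :: "('k::finite \<Rightarrow> real ^ 'n) \<Rightarrow> real ^ 'm::finite" and e :: "nat \<Rightarrow> real ^ 'm"
  assumes \<phi>: "multilinear \<phi>" "defined_over_rat \<phi>" "span (\<phi> ` rat_tuples) = UNIV"
    and e: "\<And>i x. x \<in> rat_vecs \<Longrightarrow> x \<noteq> 0 \<Longrightarrow> x \<notin> span {e i}"
  obtains u where "u \<noteq> 0" "rat_independent u" "\<And>i. u \<notin> span {e i}"
    "abs_proj u \<in> closure (projectivization (range \<phi>))" "unif_exponent (abs_proj u) \<ge> 1"
proof -
  define k where "k = CARD('k)"
  have k: "k > 0" by (simp add: k_def)
  \<comment> \<open>Step \<open>i\<close> will move argument \<open>c (i mod k)\<close> and treat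
    the form \<open>l (i div k)\<close>.\<close>
  obtain c :: "nat \<Rightarrow> 'k" where c: "bij_betw c {..<k} UNIV"
    using ex_bij_betw_nat_finite[of "UNIV :: 'k set"] by (auto simp: k_def lessThan_atLeast0)
  define Q where "Q = (rat_vecs - {0} :: (real ^ 'm) set)"
  have "1 \<in> Q" by (auto simp: Q_def rat_vecs_def vec_eq_iff)
  then have Q: "countable Q" "Q \<noteq> {}"
    using countable_rat_vecs by (auto simp: Q_def)
  define l where "l = from_nat_into Q"
  have range_l: "range l = Q" unfolding l_def using Q by (simp add: range_from_nat_into)
  have "\<exists>z. z \<in> rat_tuples \<and> l t \<bullet> \<phi> z \<noteq> 0" for t
  proof (rule ccontr)
    assume "\<not> ?thesis"
    then have "\<phi> ` rat_tuples \<subseteq> {x. l t \<bullet> x = 0}" by blast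
    then have "span (\<phi> ` rat_tuples) \<subseteq> {x. l t \<bullet> x = 0}"
      by (intro span_minimal subspace_hyperplane)
    then have "l t \<bullet> l t = 0" unfolding \<phi>(3) by blast
    moreover have "l t \<in> Q" using range_l by blast
    ultimately show False by (simp add: Q_def)
  qed
  then obtain z where z: "\<And>t. z t \<in> rat_tuples" "\<And>t. l t \<bullet> \<phi> (z t) \<noteq> 0" by metis
  text \<open>The \<open>t\<close>-th block of \<open>k\<close> steps moves every argument of \<open>\<phi>\<close> once, each time towards the
    tuple \<open>z t\<close>, so that the form \<open>l t\<close> does not vanish at the end of the block.\<close>
  define inv where "inv i s \<longleftrightarrow> (case s of (y, N, r) \<Rightarrow>
      y \<in> rat_tuples \<and> N > 0 \<and> real N *\<^sub>R \<phi> y \<in> int_vecs \<and> 0 < r \<and> r < norm (\<phi> y) / 2 \<and>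
      real i \<le> norm (real N *\<^sub>R \<phi> y) \<and>
      l (i div k) \<bullet> \<phi> (override_on (z (i div k)) y (c ` {..<i mod k})) \<noteq> 0)"
    for i and s :: "('k \<Rightarrow> real ^ 'n) \<times> nat \<times> real"
  define step where "step i s s' \<longleftrightarrow> (case (s, s') of ((y, N, r), (y', N', r')) \<Rightarrow>
      cball (\<phi> y') r' \<subseteq> cball (\<phi> y) r \<and>
      (\<forall>u\<in>cball (\<phi> y') r'. u \<notin> span {e i} \<and> (Suc i mod k = 0 \<longrightarrow> l (i div k) \<bullet> u \<noteq> 0) \<and>
        wedge_norm (real N *\<^sub>R \<phi> y) u / norm u
          \<le> norm (real N' *\<^sub>R \<phi> y') powr (1 / real (Suc i) - 1)))"
    for i and s s' :: "('k \<Rightarrow> real ^ 'n) \<times> nat \<times> real"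
  have "\<exists>s. inv 0 s"
  proof -
    have y: "\<phi> (z 0) \<noteq> 0" using z(2)[of 0] by auto
    have "\<phi> (z 0) \<in> rat_vecs" using \<phi>(2) z(1) by (auto simp: defined_over_rat_def)
    then obtain N where "N > 0" "real N *\<^sub>R \<phi> (z 0) \<in> int_vecs" by (rule rat_vecs_denominator)
    \<comment> \<open>No argument has been moved yet, so the mixed tuple is \<open>z 0\<close>
      itself.\<close>
    then have "inv 0 (z 0, N, norm (\<phi> (z 0)) / 4)"
      using z y by (simp add: inv_def)
    then show ?thesis by blast
  qed
  moreover have "\<exists>s'. inv (Suc i) s' \<and> step i s s'" if "inv i s" for i s
  proof -
    obtain y N r where s: "s = (y, N, r)" by (cases s)
    define t j J where "t = i div k" and "j = c (i mod k)" and "J = c ` {..<i mod k}"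
    have "j \<notin> J"
    proof
      assume "j \<in> J"
      then obtain a where "a < i mod k" "c a = c (i mod k)" by (auto simp: j_def J_def)
      moreover have "i mod k < k" using k by simp
      ultimately show False
        using inj_onD[OF bij_betw_imp_inj_on[OF c], of a "i mod k"] by auto
    qed
    moreover have "y \<in> rat_tuples" "N > 0" "real N *\<^sub>R \<phi> y \<in> int_vecs" "0 < r" "r < norm (\<phi> y) / 2"
      "l t \<bullet> \<phi> (override_on (z t) y J) \<noteq> 0"
      using that by (auto simp: inv_def s t_def J_def)
    ultimately obtain y' N' r' where y': "y' \<in> rat_tuples" "N' > 0" "real N' *\<^sub>R \<phi> y' \<in> int_vecs"
      "0 < r'" "r' < norm (\<phi> y') / 2" "real (Suc i) \<le> norm (real N' *\<^sub>R \<phi> y')"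
      and l': "l t \<bullet> \<phi> (override_on (z t) y' (insert j J)) \<noteq> 0"
      and sub: "cball (\<phi> y') r' \<subseteq> cball (\<phi> y) r"
      and u: "\<forall>u\<in>cball (\<phi> y') r'. u \<notin> span {e i} \<and> (l t \<bullet> \<phi> y' \<noteq> 0 \<longrightarrow> l t \<bullet> u \<noteq> 0) \<and>
        wedge_norm (real N *\<^sub>R \<phi> y) u / norm u \<le> norm (real N' *\<^sub>R \<phi> y') powr (1 / real (Suc i) - 1)"
      using perturbation_step[OF \<phi>(1,2) _ z(1), of y N r "1 / real (Suc i)" j J "l t" t "span {e i}" "real (Suc i)"]
        e[of _ i] by (auto simp del: of_nat_Suc)
    have insert_J: "insert j J = c ` {..<Suc (i mod k)}"
      by (auto simp: j_def J_def lessThan_Suc)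
    have "inv (Suc i) (y', N', r') \<and> step i s (y', N', r')"
    \<comment> \<open>At the end of a block the mixed tuple is \<open>y'\<close>, so
      \<open>l t\<close> is nonzero at \<open>\<phi> y'\<close>. The next block starts from the
      empty index set, where the invariant is the choice of \<open>z (Suc t)\<close>.\<close>
    proof (cases "Suc (i mod k) = k")
      case True
      then have "insert j J = UNIV" using insert_J c by (simp add: bij_betw_def)
      then have "l t \<bullet> \<phi> y' \<noteq> 0" using l' by (simp add: override_on_def)
      then show ?thesis
        using y' u sub z True by (auto simp: inv_def step_def s t_def mod_Suc simp del: of_nat_Suc)
    next
      case False
      then show ?thesis
        using y' u sub l' by (auto simp: inv_def step_def s t_def insert_J mod_Suc div_Suc simp del: of_nat_Suc)
    qed
    then show ?thesis by blast
  qed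
  ultimately obtain f where f: "\<And>i. inv i (f i)" "\<And>i. step i (f i) (f (Suc i))"
    using dependent_nat_choice[of inv step] by blast
  define y N r where "y i = fst (f i)" and "N i = fst (snd (f i))" and "r i = snd (snd (f i))" for i
  have f_eq: "f i = (y i, N i, r i)" for i by (simp add: y_def N_def r_def)
  define x F where "x i = real (N i) *\<^sub>R \<phi> (y i)" and "F i = cball (\<phi> (y i)) (r i)" for i
  have x_int: "x i \<in> int_vecs" and norm_x: "real i \<le> norm (x i)" and N: "N i > 0"
    and r: "0 < r i" "r i < norm (\<phi> (y i)) / 2" for i
    using f(1)[of i] by (auto simp: inv_def f_eq x_def)
  have "F (Suc i) \<subseteq> F i" for i
    using f(2)[of i] by (simp add: step_def f_eq F_def)
  then have "F j \<subseteq> F i" if "i \<le> j" for i j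
    using that decseq_SucI[of F] by (simp add: decseq_def)
  then have "\<Inter> (range F) \<noteq> {}"
    using less_imp_le[OF r(1)] by (intro compact_nest) (simp_all add: F_def not_less)
  then obtain u where uF: "\<And>i. u \<in> F i" by blast
  have u_e: "u \<notin> span {e i}" and u_l: "Suc i mod k = 0 \<Longrightarrow> l (i div k) \<bullet> u \<noteq> 0"
    and u_x: "wedge_norm (x i) u / norm u \<le> norm (x (Suc i)) powr (1 / real (Suc i) - 1)" for i
    using f(2)[of i] uF[of "Suc i"] by (auto simp: step_def f_eq F_def x_def)
  have u0: "u \<noteq> 0" using u_e[of 0] span_zero by metis
  have x0: "x i \<noteq> 0" for i using N[of i] r[of i] by (auto simp: x_def)
  have \<phi>_y0: "\<phi> (y i) \<noteq> 0" for i using x0[of i] by (auto simp: x_def)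
  have "q \<bullet> u \<noteq> 0" if "q \<in> rat_vecs" "q \<noteq> 0" for q
  proof -
    have "q \<in> range l" using that range_l by (simp add: Q_def)
    then obtain t where "q = l t" by blast
    \<comment> \<open>This index is the last step of block \<open>t\<close>.\<close>
    moreover have "(t * k + (k - 1)) div k = t"
      using k div_mult_self3[of k t "k - 1"] by (simp del: div_mult_self3)
    moreover have "Suc (t * k + (k - 1)) mod k = 0"
      using k by simp
    ultimately show ?thesis using u_l[of "t * k + (k - 1)"] by simp
  qed
  then have li: "rat_independent u" by (rule rat_independentI)
  have exponent: "\<forall>\<^sub>F X in at_top. min_approx_dist (abs_proj u) X \<le> X powr - (1 - 1 / real (Suc m))" for m
    using eventually_ge_at_top[of "max 1 (norm (x m))"]
  proof eventually_elim
    case (elim X)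
    \<comment> \<open>The norms of the \<open>x i\<close> need not increase, so \<open>n\<close> is
      the first index after \<open>m\<close> whose norm exceeds \<open>X\<close>. The preceding
      point has norm at most \<open>X\<close>, by minimality or, at index \<open>m\<close>, by the
      lower bound on \<open>X\<close>.\<close>
    define n where "n = (LEAST n. m < n \<and> X < norm (x n))"
    obtain n0 where n0: "real n0 > X" using reals_Archimedean2 by blast
    have "X < norm (x (max n0 (Suc m)))"
      using n0 norm_x[of "max n0 (Suc m)"] by linarith
    then have "\<exists>n. m < n \<and> X < norm (x n)" by (intro exI[of _ "max n0 (Suc m)"]) auto
    then have n: "m < n" "X < norm (x n)"
      unfolding n_def by (metis (mono_tags, lifting) LeastI_ex)+
    define i where "i = n - 1"
    have i: "n = Suc i" "m \<le> i" using n(1) by (auto simp: i_def)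
    have "norm (x i) \<le> X"
    proof (cases "i = m")
      case True
      then show ?thesis using elim by simp
    next
      case False
      then show ?thesis
        using not_less_Least[of i "\<lambda>n. m < n \<and> X < norm (x n)"] i by (auto simp: n_def[symmetric])
    qed
    then have "x i \<in> int_points X"
      using x_int[of i] x0[of i] by (simp add: int_points_def int_vecs_def)
    then have "min_approx_dist (abs_proj u) X \<le> wedge_norm (x i) u / norm u"
      using min_approx_dist_le approx_dist_abs_proj[OF u0] by metis
    also have "\<dots> \<le> norm (x (Suc i)) powr (1 / real (Suc i) - 1)" by (rule u_x)
    also have "\<dots> \<le> X powr (1 / real (Suc i) - 1)"
      using n(2) i elim by (intro powr_mono2') auto
    also have "\<dots> \<le> X powr - (1 - 1 / real (Suc m))"
      using i elim by (intro powr_mono) (auto simp: field_simps)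
    finally show ?case .
  qed
  have "unif_exponent (abs_proj u) \<ge> ereal (1 - 1 / real (Suc m))" for m
    unfolding unif_exponent_def using exponent[of m] by (intro Sup_upper) blast
  moreover have "(\<lambda>m. ereal (1 - 1 / real (Suc m))) \<longlonglongrightarrow> ereal 1"
    by (intro tendsto_ereal) real_asymp
  ultimately have "unif_exponent (abs_proj u) \<ge> ereal 1"
    using LIMSEQ_le_const2 by blast
  then have "unif_exponent (abs_proj u) \<ge> 1" by (simp only: one_ereal_def)
  moreover have "abs_proj u \<in> closure (projectivization (range \<phi>))"
    unfolding closure_sequential
  proof (intro exI conjI allI)
    fix i
    \<comment> \<open>The sequence starts at index 1, since at index 0 the exponent
      \<open>1 / real (Suc i) - 1\<close> is 0; from index 1 on it is at most
      \<open>- 1 / 2\<close>.\<close>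
    show "abs_proj (\<phi> (y (Suc i))) \<in> projectivization (range \<phi>)"
      using \<phi>_y0 by (auto simp: projectivization_def)
  next
    have bound: "dist (abs_proj (\<phi> (y i))) (abs_proj u) \<le> norm (x (Suc i)) powr (1 / real (Suc i) - 1)" for i
    proof -
      have "dist (abs_proj (\<phi> (y i))) (abs_proj u) = wedge_norm (x i) u / norm u / norm (x i)"
        using N[of i] by (simp add: dist_abs_proj \<phi>_y0 u0 x_def wedge_norm_scale_left)
      also have "\<dots> \<le> wedge_norm (x i) u / norm u / 1"
        using x0[of i] by (intro divide_left_mono int_vecs_norm_ge_1 x_int) (auto simp: wedge_norm_nonneg)
      finally show ?thesis using u_x[of i] by simp
    qed
    have "dist (abs_proj (\<phi> (y (Suc i)))) (abs_proj u) \<le> real (Suc (Suc i)) powr (- 1 / 2)" for i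
    proof -
      have "1 / real (Suc (Suc i)) - 1 \<le> - 1 / 2" by (simp add: field_simps)
      moreover have "1 \<le> norm (x (Suc (Suc i)))" using x_int x0 int_vecs_norm_ge_1 by blast
      ultimately have "norm (x (Suc (Suc i))) powr (1 / real (Suc (Suc i)) - 1)
          \<le> norm (x (Suc (Suc i))) powr (- 1 / 2)"
        by (intro powr_mono) auto
      also have "\<dots> \<le> real (Suc (Suc i)) powr (- 1 / 2)"
        using norm_x[of "Suc (Suc i)"] by (intro powr_mono2') auto
      finally show ?thesis using bound[of "Suc i"] by simp
    qed
    then have le: "\<forall>i. dist (abs_proj (\<phi> (y (Suc i)))) (abs_proj u) \<le> real (Suc (Suc i)) powr (- 1 / 2)"
      by blast
    have "(\<lambda>i. real (Suc (Suc i)) powr (- 1 / 2)) \<longlonglongrightarrow> 0" by real_asymp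
    from tendsto_sandwich[OF _ always_eventually[OF le] tendsto_const this]
    have "(\<lambda>i. dist (abs_proj (\<phi> (y (Suc i)))) (abs_proj u)) \<longlonglongrightarrow> 0"
      by simp
    then show "(\<lambda>i. abs_proj (\<phi> (y (Suc i)))) \<longlonglongrightarrow> abs_proj u"
      by (rule tendsto_dist_iff[THEN iffD2])
  qed
  ultimately show ?thesis
    using that[OF u0 li u_e] by blast
qed

text \<open>Diagonal argument: if the solutions were countable, their representatives could be
  listed as the \<open>e i\<close>, and the construction would give a solution off all these
  lines.\<close>

theorem theorem1p1:
  fixes \<phi> :: "('k::finite \<Rightarrow> real ^ 'n::finite) \<Rightarrow> real ^ 'm::finite"
    and Z :: "'m proj set"
  assumes "CARD('m) \<ge> 3"
    and "multilinear \<phi>"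
    and "defined_over_rat \<phi>"
    and "span (\<phi> ` rat_tuples) = UNIV"
    and "Z = closure (projectivization (range \<phi>))"
  shows "uncountable {\<xi> \<in> li_points Z. unif_exponent \<xi> = 1} \<and> unif_exponent_set Z = 1"
proof -
  have card: "CARD('m) \<ge> 2" using assms(1) by simp
  have le_1: "unif_exponent \<xi> \<le> 1" if "\<xi> \<in> li_points Z" for \<xi>
    using that unif_exponent_le_1[OF card] by (auto simp: li_points_def)
  let ?S = "{\<xi> \<in> li_points Z. unif_exponent \<xi> = 1}"
  have unc: "uncountable ?S"
  proof
    assume S: "countable ?S"
    have "\<forall>\<xi>\<in>?S. \<exists>x. x \<noteq> 0 \<and> \<xi> = abs_proj x \<and> rat_independent x"
      by (auto simp: li_points_def)
    then obtain rep where rep: "\<And>\<xi>. \<xi> \<in> ?S \<Longrightarrow> rep \<xi> \<noteq> 0 \<and> \<xi> = abs_proj (rep \<xi>) \<and> rat_independent (rep \<xi>)"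
      by metis
    \<comment> \<open>Inserting 0 makes the set nonempty, hence enumerable; its span contains no
      nonzero vector, so the requirement on \<open>e\<close> still holds.\<close>
    define R where "R = insert 0 (rep ` ?S)"
    define e where "e = from_nat_into R"
    have range_e: "range e = R"
      unfolding e_def using S by (intro range_from_nat_into) (auto simp: R_def)
    have "x \<notin> span {e i}" if "x \<in> rat_vecs" "x \<noteq> 0" for i and x :: "real ^ 'm"
    proof -
      have "e i \<in> R" using range_e by blast
      then show ?thesis
        using that rep rat_independent_not_rational[OF card] by (auto simp: R_def)
    qed
    then obtain u where u: "u \<noteq> 0" "rat_independent u" "\<And>i. u \<notin> span {e i}"
      "abs_proj u \<in> closure (projectivization (range \<phi>))" "unif_exponent (abs_proj u) \<ge> 1"
      using exists_well_approximable_point[OF assms(2-4)] by blast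
    then have "abs_proj u \<in> li_points Z" by (auto simp: li_points_def assms(5))
    then have uS: "abs_proj u \<in> ?S" using le_1 u(5) by (auto intro: antisym)
    then have "rep (abs_proj u) \<in> range e" by (simp add: range_e R_def)
    then obtain i where "rep (abs_proj u) = e i" by auto
    moreover have "u \<in> span {rep (abs_proj u)}"
      using rep[OF uS] u(1) by (intro abs_proj_eqD) auto
    ultimately show False using u(3) by simp
  qed
  then have "?S \<noteq> {}" by (metis countable_empty)
  then obtain \<xi> where "\<xi> \<in> li_points Z" "unif_exponent \<xi> = 1" by blast
  then have "unif_exponent_set Z = 1"
    unfolding unif_exponent_set_def using le_1 by (intro antisym SUP_least) (auto intro: SUP_upper2)
  then show ?thesis using unc by blast
qed

end
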